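(* Let $k\ge 2$ and $\ell\ge 1$, and let $G_1,\dots,G_\ell$ be finite graphs on the same vertex set $V$, where $G_i$ has $m_i$ edges. Then there is a partition of $V$ into $k$ classes $V_1,\dots,V_k$ such that for all $i=1,\dots,\ell$ the number of edges of $G_i$ whose two endvertices lie in different classes $V_s\neq V_t$ is at least $$\frac{(k-1)m_i}{k}-\sqrt{2\ell m_i}.$$
   Context: Graphs are finite and simple. A partition of $V$ into $k$ classes means pairwise disjoint sets $V_1,\dots,V_k$ with union $V$ (classes are allowed to be empty). *)

theory Defs
  imports Complex_Main "HOL-Library.Disjoint_Sets" "HOL-Library.Ramsey"
begin

(* [V]^2 is the library's set of 2-element subsets of V: no loops, no multiple edges. *)
definition fin_simple_graph :: "'a set \<Rightarrow> 'a set set \<Rightarrow> bool" where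
  "fin_simple_graph V E \<longleftrightarrow> finite V \<and> E \<subseteq> [V]\<^bsup>2\<^esup>"

(* The classes are P 1, ..., P k. They are indexed, not collected in a set of sets,
   because several of them may be empty. *)
definition partition_into :: "nat \<Rightarrow> 'a set \<Rightarrow> (nat \<Rightarrow> 'a set) \<Rightarrow> bool" where
  "partition_into k V P \<longleftrightarrow> disjoint_family_on P {1..k} \<and> (\<Union>s\<in>{1..k}. P s) = V"

definition crossing_edges :: "nat \<Rightarrow> (nat \<Rightarrow> 'a set) \<Rightarrow> 'a set set \<Rightarrow> 'a set set" where
  "crossing_edges k P E =
     {e \<in> E. \<exists>s\<in>{1..k}. \<exists>t\<in>{1..k}. s \<noteq> t \<and> (\<exists>u\<in>P s. \<exists>v\<in>P t. e = {u, v})}"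

end

theory Submission
  imports Defs "HOL-Library.FuncSet"
begin

text \<open>
  Colour the vertices uniformly at random with \<open>k\<close> colours. The events that an edge is monochromatic
  have probability \<open>1 / k\<close> and are pairwise independent, even for adjacent edges: two distinct edges
  differ in some vertex, and recolouring only that vertex decides one event while leaving the other
  unchanged. So the number of monochromatic edges of \<open>G\<^sub>i\<close> has variance at most \<open>m\<^sub>i\<close>, and by
  Chebyshev's inequality and the union bound some colouring is good for all graphs at once.
\<close>

text \<open>The centred indicator of the event that \<open>e\<close> is monochromatic under
  \<open>c\<close>: for a 2-element \<open>e\<close> its mean over uniformly random colourings is 0.
  Testing the size of the image avoids naming the endvertices.\<close>

definition mono_dev :: "nat \<Rightarrow> ('a \<Rightarrow> nat) \<Rightarrow> 'a set \<Rightarrow> real" where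
  "mono_dev k c e = of_bool (card (c ` e) = 1) - 1 / real k"

lemma mono_dev_doubleton: "mono_dev k c {u, v} = of_bool (c v = c u) - 1 / real k"
  by (auto simp: mono_dev_def card_insert_if)

lemma mono_dev_square_le_1:
  assumes "k \<ge> 1"
  shows "(mono_dev k c e)\<^sup>2 \<le> 1"
proof -
  have "0 \<le> 1 / real k" "1 / real k \<le> 1"
    using assms by auto
  then have "\<bar>mono_dev k c e\<bar> \<le> 1"
    by (auto simp: mono_dev_def)
  then show ?thesis
    by (simp add: abs_square_le_1)
qed

text \<open>Allows averaging over the colour of \<open>v\<close> alone while all other colours stay
  fixed.\<close>

lemma sum_PiE_insert:
  fixes h :: "('a \<Rightarrow> 'b) \<Rightarrow> 'c::comm_monoid_add"
  assumes "v \<notin> W"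
  shows "(\<Sum>c\<in>PiE (insert v W) A. h c) = (\<Sum>g\<in>PiE W A. \<Sum>y\<in>A v. h (g(v := y)))"
proof -
  have inj: "inj_on (\<lambda>(y, g). g(v := y)) (A v \<times> PiE W A)"
    using assms by (rule inj_combinator)
  have "(\<Sum>c\<in>PiE (insert v W) A. h c) = (\<Sum>y\<in>A v. \<Sum>g\<in>PiE W A. h (g(v := y)))"
    unfolding PiE_insert_eq sum.reindex[OF inj]
    by (simp add: sum.cartesian_product case_prod_unfold)
  then show ?thesis
    by (subst sum.swap)
qed

text \<open>Fix all colours except that of \<open>v\<close>. Then \<open>g\<close> is constant, and
  exactly one of the \<open>k\<close> choices for \<open>v\<close> agrees with the colour of
  \<open>u\<close>, so the deviations add up to \<open>1 - k * (1 / k) = 0\<close>.\<close>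

lemma sum_mult_mono_dev_eq_0:
  fixes g :: "('a \<Rightarrow> nat) \<Rightarrow> real"
  assumes "u \<in> V" "v \<in> V" "u \<noteq> v"
    and g: "\<And>c y. g (c(v := y)) = g c"
  shows "(\<Sum>c\<in>V \<rightarrow>\<^sub>E {1..k}. g c * mono_dev k c {u, v}) = 0"
proof -
  define W where "W = V - {v}"
  have V: "V = insert v W" "v \<notin> W" "u \<in> W"
    using assms by (auto simp: W_def)
  have "(\<Sum>y\<in>{1..k}. g (c(v := y)) * mono_dev k (c(v := y)) {u, v}) = 0"
    if c: "c \<in> W \<rightarrow>\<^sub>E {1..k}" for c
  proof -
    have cu: "c u \<in> {1..k}"
      using c V by auto
    have "(\<Sum>y\<in>{1..k}. g (c(v := y)) * mono_dev k (c(v := y)) {u, v})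
        = g c * (\<Sum>y\<in>{1..k}. of_bool (y = c u) - 1 / real k)"
      using assms by (simp add: g mono_dev_doubleton sum_distrib_left)
    also have "\<dots> = 0"
      using cu by (simp add: sum_subtractf of_bool_def)
    finally show ?thesis .
  qed
  then show ?thesis
    unfolding V(1) sum_PiE_insert[OF V(2)] by (intro sum.neutral) blast
qed

lemma sum_mono_dev_mult_eq_0:
  assumes "e \<in> [V]\<^bsup>2\<^esup>" "f \<in> [V]\<^bsup>2\<^esup>" "e \<noteq> f"
  shows "(\<Sum>c\<in>V \<rightarrow>\<^sub>E {1..k}. mono_dev k c f * mono_dev k c e) = 0"
proof -
  have "finite e" "finite f" "card e = 2" "card f = 2" "e \<subseteq> V"
    using assms by (auto simp: nsets_def)
  \<comment> \<open>Otherwise \<open>e\<close> is a subset of \<open>f\<close> of the same size,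
    hence equal to it.\<close>
  then obtain v where v: "v \<in> e" "v \<notin> f"
    using assms(3) by (metis card_subset_eq subsetI)
  obtain u where u: "e = {u, v}" "u \<noteq> v"
    using \<open>card e = 2\<close> v(1) by (auto simp: card_2_iff)
  have "mono_dev k (c(v := y)) f = mono_dev k c f" for c y
  proof -
    have "c(v := y) ` f = c ` f"
      using v(2) by (auto simp: image_iff)
    then show ?thesis
      by (simp add: mono_dev_def)
  qed
  then show ?thesis
    unfolding u(1) using u \<open>e \<subseteq> V\<close> by (intro sum_mult_mono_dev_eq_0) auto
qed

text \<open>The variance bound, multiplied by the number of colourings. Expanding the square, the
  mixed terms cancel by pairwise independence, and each diagonal term is at most 1.\<close>

lemma sum_square_sum_mono_dev_le:
  assumes "k \<ge> 1" "finite E" "E \<subseteq> [V]\<^bsup>2\<^esup>"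
  shows "(\<Sum>c\<in>V \<rightarrow>\<^sub>E {1..k}. (\<Sum>e\<in>E. mono_dev k c e)\<^sup>2)
           \<le> real (card E) * real (card (V \<rightarrow>\<^sub>E {1..k}))"
proof -
  let ?C = "V \<rightarrow>\<^sub>E {1..k}"
  have "(\<Sum>c\<in>?C. (\<Sum>e\<in>E. mono_dev k c e)\<^sup>2)
      = (\<Sum>c\<in>?C. \<Sum>e\<in>E. \<Sum>f\<in>E. mono_dev k c f * mono_dev k c e)"
    by (simp add: power2_eq_square sum_product mult.commute)
  also have "\<dots> = (\<Sum>e\<in>E. \<Sum>f\<in>E. \<Sum>c\<in>?C. mono_dev k c f * mono_dev k c e)"
    by (subst sum.swap, intro sum.cong refl, rule sum.swap)
  also have "\<dots> = (\<Sum>e\<in>E. \<Sum>f\<in>E. if f = e then \<Sum>c\<in>?C. (mono_dev k c e)\<^sup>2 else 0)"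
  proof (intro sum.cong refl)
    fix e f assume "e \<in> E" "f \<in> E"
    then show "(\<Sum>c\<in>?C. mono_dev k c f * mono_dev k c e)
        = (if f = e then \<Sum>c\<in>?C. (mono_dev k c e)\<^sup>2 else 0)"
      using assms(3) sum_mono_dev_mult_eq_0[of e V f k] by (auto simp: power2_eq_square)
  qed
  also have "\<dots> = (\<Sum>e\<in>E. \<Sum>c\<in>?C. (mono_dev k c e)\<^sup>2)"
    using assms(2) by simp
  also have "\<dots> \<le> (\<Sum>e\<in>E. \<Sum>c\<in>?C. 1)"
    by (intro sum_mono mono_dev_square_le_1 assms)
  finally show ?thesis
    by simp
qed

lemma partition_into_colour_classes:
  assumes "c \<in> V \<rightarrow>\<^sub>E {1..k}"
  shows "partition_into k V (\<lambda>s. {v \<in> V. c v = s})"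
  using assms by (fastforce simp: partition_into_def disjoint_family_on_def)

lemma crossing_edges_colour_classes:
  assumes "c \<in> V \<rightarrow>\<^sub>E {1..k}" "E \<subseteq> [V]\<^bsup>2\<^esup>"
  shows "crossing_edges k (\<lambda>s. {v \<in> V. c v = s}) E = {e \<in> E. card (c ` e) \<noteq> 1}"
proof -
  have "(\<exists>s\<in>{1..k}. \<exists>t\<in>{1..k}. s \<noteq> t \<and> (\<exists>u\<in>{v \<in> V. c v = s}. \<exists>v\<in>{v \<in> V. c v = t}. e = {u, v}))
      \<longleftrightarrow> card (c ` e) \<noteq> 1" if "e \<in> E" for e
  proof -
    have "card e = 2" "e \<subseteq> V"
      using that assms(2) by (auto simp: nsets_def)
    then obtain u v where e: "e = {u, v}" "u \<in> V" "v \<in> V"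
      by (auto simp: card_2_iff)
    \<comment> \<open>The classes in question can only be those of \<open>c u\<close> and
      \<open>c v\<close>, in either order.\<close>
    then have "c u \<in> {1..k}" "c v \<in> {1..k}"
      using assms(1) by auto
    then have "c u \<noteq> c v \<longleftrightarrow> (\<exists>s\<in>{1..k}. \<exists>t\<in>{1..k}. s \<noteq> t \<and>
        (\<exists>u\<in>{v \<in> V. c v = s}. \<exists>v\<in>{v \<in> V. c v = t}. e = {u, v}))"
      using e by (fastforce simp: doubleton_eq_iff)
    moreover have "card (c ` e) \<noteq> 1 \<longleftrightarrow> c u \<noteq> c v"
      by (auto simp: e(1) card_insert_if)
    ultimately show ?thesis
      by blast
  qed
  then show ?thesis
    unfolding crossing_edges_def by blast
qed

text \<open>Since the deviations are centred, crossing edges fall short of their mean by exactly the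
  sum of the deviations; an upper bound on that sum is all that is needed.\<close>

lemma card_crossing_edges_colour_classes:
  assumes "k \<ge> 1" "c \<in> V \<rightarrow>\<^sub>E {1..k}" "finite E" "E \<subseteq> [V]\<^bsup>2\<^esup>"
  shows "real (card (crossing_edges k (\<lambda>s. {v \<in> V. c v = s}) E))
           = (real k - 1) * real (card E) / real k - (\<Sum>e\<in>E. mono_dev k c e)"
proof -
  have "real (card {e \<in> E. card (c ` e) \<noteq> 1}) = (\<Sum>e\<in>E. of_bool (card (c ` e) \<noteq> 1))"
    using assms(3) by (simp add: sum_of_bool_eq Int_def)
  also have "\<dots> = (\<Sum>e\<in>E. (1 - 1 / real k) - mono_dev k c e)"
    by (intro sum.cong) (auto simp: mono_dev_def)
  also have "\<dots> = (real k - 1) * real (card E) / real k - (\<Sum>e\<in>E. mono_dev k c e)"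
    unfolding sum_subtractf using assms(1) by (simp add: field_simps)
  finally show ?thesis
    using assms by (simp add: crossing_edges_colour_classes)
qed

text \<open>Chebyshev and the union bound in one weighted count: the average over \<open>C\<close>
  of the sum of \<open>(S i c)\<^sup>2 / m i\<close> is at most \<open>card I\<close>, but a
  violated bound at every \<open>c\<close> would make it at least twice that.\<close>

lemma exists_all_small_deviations:
  fixes S :: "'i \<Rightarrow> 'c \<Rightarrow> real"
  assumes "finite C" "C \<noteq> {}" "finite I"
    and nonneg: "\<And>i. i \<in> I \<Longrightarrow> 0 \<le> m i"
    and zero: "\<And>i c. i \<in> I \<Longrightarrow> c \<in> C \<Longrightarrow> m i = 0 \<Longrightarrow> S i c = 0"
    and var: "\<And>i. i \<in> I \<Longrightarrow> (\<Sum>c\<in>C. (S i c)\<^sup>2) \<le> m i * real (card C)"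
  shows "\<exists>c\<in>C. \<forall>i\<in>I. S i c \<le> sqrt (2 * real (card I) * m i)"
proof (rule ccontr)
  assume "\<not> ?thesis"
  then have bad: "\<exists>i\<in>I. S i c > sqrt (2 * real (card I) * m i)" if "c \<in> C" for c
    using that by (meson not_le)
  have "I \<noteq> {}"
    using bad assms(2) by auto
  then have I: "real (card I) > 0"
    using assms(3) by (simp add: card_gt_0_iff)
  have C: "real (card C) > 0"
    using assms(1,2) by (simp add: card_gt_0_iff)
  have large: "2 * real (card I) \<le> (\<Sum>i\<in>I. (S i c)\<^sup>2 / m i)" if "c \<in> C" for c
  proof -
    obtain i where i: "i \<in> I" "S i c > sqrt (2 * real (card I) * m i)"
      using bad \<open>c \<in> C\<close> by blast
    \<comment> \<open>If \<open>m i = 0\<close>, the violated bound reads \<open>S i c > 0\<close>,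
      against \<open>zero\<close>.\<close>
    then have "m i > 0"
      using zero[OF i(1) that] nonneg[OF i(1)] by (cases "m i = 0") auto
    moreover have "2 * real (card I) * m i \<le> (S i c)\<^sup>2"
      using i(2) by (intro sqrt_le_D) simp
    ultimately have "2 * real (card I) \<le> (S i c)\<^sup>2 / m i"
      by (simp add: field_simps)
    also have "\<dots> \<le> (\<Sum>i\<in>I. (S i c)\<^sup>2 / m i)"
      using i(1) assms(3) nonneg by (intro member_le_sum) auto
    finally show ?thesis .
  qed
  have "real (card C) * (2 * real (card I)) \<le> (\<Sum>c\<in>C. \<Sum>i\<in>I. (S i c)\<^sup>2 / m i)"
    using sum_mono[OF large] by simp
  also have "\<dots> = (\<Sum>i\<in>I. (\<Sum>c\<in>C. (S i c)\<^sup>2) / m i)"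
    by (subst sum.swap) (simp add: sum_divide_distrib)
  also have "\<dots> \<le> (\<Sum>i\<in>I. real (card C))"
  proof (rule sum_mono)
    fix i assume "i \<in> I"
    \<comment> \<open>For \<open>m i = 0\<close> the quotient is 0 by the convention for division by
      zero.\<close>
    then show "(\<Sum>c\<in>C. (S i c)\<^sup>2) / m i \<le> real (card C)"
      using var[of i] nonneg[of i] by (cases "m i = 0") (auto simp: field_simps)
  qed
  \<comment> \<open>The factor 2 under the root gives the contradiction, as \<open>C\<close> and
    \<open>I\<close> are nonempty.\<close>
  finally show False
    using I C by simp
qed

theorem theorem2:
  fixes k l :: nat
    and V :: "'a set"
    and E :: "nat \<Rightarrow> 'a set set"
    and m :: "nat \<Rightarrow> nat"
  assumes "k \<ge> 2" and "l \<ge> 1"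
    and "\<And>i. i \<in> {1..l} \<Longrightarrow> fin_simple_graph V (E i)"
    and "\<And>i. i \<in> {1..l} \<Longrightarrow> card (E i) = m i"
  shows "\<exists>P. partition_into k V P \<and>
           (\<forall>i\<in>{1..l}. real (card (crossing_edges k P (E i)))
              \<ge> (real k - 1) * real (m i) / real k - sqrt (2 * real l * real (m i)))"
proof -
  let ?C = "V \<rightarrow>\<^sub>E {1..k}"
  \<comment> \<open>Read off the first graph, which exists because \<open>l \<ge> 1\<close>.\<close>
  have "finite V"
    using assms(2) assms(3)[of 1] by (simp add: fin_simple_graph_def)
  have edges: "E i \<subseteq> [V]\<^bsup>2\<^esup>" if "i \<in> {1..l}" for i
    using assms(3)[OF that] by (simp add: fin_simple_graph_def)
  have fin: "finite (E i)" if "i \<in> {1..l}" for i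
    using edges[OF that] finite_imp_finite_nsets[OF \<open>finite V\<close>] finite_subset by blast
  have "\<exists>c\<in>?C. \<forall>i\<in>{1..l}. (\<Sum>e\<in>E i. mono_dev k c e)
          \<le> sqrt (2 * real (card {1..l}) * real (m i))"
  proof (rule exists_all_small_deviations)
    show "finite ?C"
      using \<open>finite V\<close> by (intro finite_PiE) auto
    show "?C \<noteq> {}"
      using assms(1) by (simp add: PiE_eq_empty_iff)
    \<comment> \<open>A graph with \<open>m i = 0\<close> has no edges, so the sum is empty.\<close>
    show "(\<Sum>e\<in>E i. mono_dev k c e) = 0" if "i \<in> {1..l}" "real (m i) = 0" for i c
      using that fin[of i] assms(4)[of i] by simp
    show "(\<Sum>c\<in>?C. (\<Sum>e\<in>E i. mono_dev k c e)\<^sup>2) \<le> real (m i) * real (card ?C)"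
      if "i \<in> {1..l}" for i
      using sum_square_sum_mono_dev_le[OF _ fin[OF that] edges[OF that], of k]
        assms(1) assms(4)[OF that] by simp
  qed auto
  then obtain c where c: "c \<in> ?C"
    and small: "\<And>i. i \<in> {1..l} \<Longrightarrow> (\<Sum>e\<in>E i. mono_dev k c e) \<le> sqrt (2 * real l * real (m i))"
    by auto
  have "real (card (crossing_edges k (\<lambda>s. {v \<in> V. c v = s}) (E i)))
      \<ge> (real k - 1) * real (m i) / real k - sqrt (2 * real l * real (m i))"
    if i: "i \<in> {1..l}" for i
    using card_crossing_edges_colour_classes[OF _ c fin[OF i] edges[OF i]]
      small[OF i] assms(1) assms(4)[OF i] by simp
  with partition_into_colour_classes[OF c] show ?thesis
    by blast
qed

end
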